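(* Fix $p \in (0,1)$ (a constant independent of $n$). The following property holds asymptotically almost surely for $G = (V,E) \in \mathcal{G}(n,p)$: $$ \mathrm{pq}(G) = \Theta \big( \mathrm{eq}(G) \big) = \Theta ( \log n ). $$
   Context: Query game on a simple graph $G=(V,E)$: $d_G(u,v)$ denotes the graph distance. An adversary fixes a target vertex $v^*\in V$ unknown to an adaptive algorithm. In each round the algorithm queries two vertices $u,v$, and the adversary replies with whichever of $u,v$ is closer to $v^*$ (with either one, at the adversary's choice, if $d_G(u,v^* )=d_G(v,v^* )$). Equivalently: put $V_0=V$; in round $t$ the algorithm presents $(u_t,v_t)$ (depending on $G$ and earlier replies) and the adversary chooses either $V_t=\{x\in V_{t-1}: d_G(u_t,x)\le d_G(v_t,x)\}$ (reply $u_t$) or $V_t=\{x\in V_{t-1}: d_G(v_t,x)\le d_G(u_t,x)\}$ (reply $v_t$); the target is located once $|V_t|=1$. A pair query allows arbitrary $u,v\in V$; an edge query requires $u$ and $v$ to be adjacent. $\mathrm{pq}(G)$ (respectively $\mathrm{eq}(G)$) is the least integer $t$ such that the algorithm can locate the target in at most $t$ pair queries (respectively edge queries), regardless of the strategy of the adversary. $\mathcal{G}(n,p)$ is the binomial random graph on vertex set $\{1,\dots,n\}$, each pair being an edge independently with probability $p$. A property holds asymptotically almost surely (a.a.s.) if its probability tends to $1$ as $n\to\infty$. $\log$ is the natural logarithm; the constants hidden in $\Theta$ may depend on $p$. *)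

theory Defs
  imports "HOL-Probability.Probability"
begin

text \<open>A simple graph is given by its vertex set \<open>V\<close> and its set \<open>E\<close> of edges, each edge being
  a two-element subset of \<open>V\<close>. The distance is \<open>\<infinity>\<close> between different components.\<close>

definition adj :: "'a set set \<Rightarrow> ('a \<times> 'a) set" where
  "adj E = {(u, v). {u, v} \<in> E}"

definition graph_dist :: "'a set set \<Rightarrow> 'a \<Rightarrow> 'a \<Rightarrow> enat" where
  "graph_dist E u v = Inf {enat k | k. (u, v) \<in> adj E ^^ k}"

text \<open>A strategy of the algorithm maps the list of replies received so far, \<^emph>\<open>most recent first\<close>,
  to the next queried pair.\<close>

type_synonym 'a strategy = "'a list \<Rightarrow> 'a \<times> 'a"

definition truthful_reply :: "'a set set \<Rightarrow> 'a \<times> 'a \<Rightarrow> 'a \<Rightarrow> 'a \<Rightarrow> bool" where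
  "truthful_reply E q r x \<longleftrightarrow> (case q of (u, v) \<Rightarrow>
     (r = u \<and> graph_dist E u x \<le> graph_dist E v x) \<or>
     (r = v \<and> graph_dist E v x \<le> graph_dist E u x))"

text \<open>The set \<open>V\<^sub>t\<close> of the vertices that are still possible targets after \<open>t\<close> replies:\<close>

primrec candidates :: "'a set \<Rightarrow> 'a set set \<Rightarrow> 'a strategy \<Rightarrow> 'a list \<Rightarrow> 'a set" where
  "candidates V E \<sigma> [] = V"
| "candidates V E \<sigma> (r # rs) = {x \<in> candidates V E \<sigma> rs. truthful_reply E (\<sigma> rs) r x}"

text \<open>The algorithm, restricted to queries from \<open>Q\<close>, can locate the target within \<open>t\<close> queries.
  The adversary plays a target \<open>x\<close> and any replies \<open>rs\<close> that are truthful for \<open>x\<close>, which is what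
  \<open>x \<in> candidates V E \<sigma> rs\<close> says. Playing exactly \<open>t\<close> rounds does not change the least \<open>t\<close>, because a located
  target stays located whatever is queried afterwards.\<close>

definition can_locate :: "'a set \<Rightarrow> 'a set set \<Rightarrow> ('a \<times> 'a) set \<Rightarrow> nat \<Rightarrow> bool" where
  "can_locate V E Q t \<longleftrightarrow> (\<exists>\<sigma>. (\<forall>rs. length rs < t \<longrightarrow> \<sigma> rs \<in> Q) \<and>
     (\<forall>x\<in>V. \<forall>rs. length rs = t \<and> x \<in> candidates V E \<sigma> rs \<longrightarrow> card (candidates V E \<sigma> rs) = 1))"

text \<open>The query numbers are \<open>\<infinity>\<close> if the target cannot be located at all; this happens for edge
  queries on disconnected graphs.\<close>

definition pq_num :: "'a set \<Rightarrow> 'a set set \<Rightarrow> enat" where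
  "pq_num V E = Inf {enat t | t. can_locate V E (V \<times> V) t}"

definition eq_num :: "'a set \<Rightarrow> 'a set set \<Rightarrow> enat" where
  "eq_num V E = Inf {enat t | t. can_locate V E (adj E) t}"

definition vertex_pairs :: "nat \<Rightarrow> nat set set" where
  "vertex_pairs n = {e. e \<subseteq> {1..n} \<and> card e = 2}"

text \<open>The edge set of the binomial random graph on the vertex set \<open>{1..n}\<close>:\<close>

definition gnp :: "nat \<Rightarrow> real \<Rightarrow> nat set set pmf" where
  "gnp n p = map_pmf (\<lambda>f. {e \<in> vertex_pairs n. f e})
               (Pi_pmf (vertex_pairs n) False (\<lambda>_. bernoulli_pmf p))"

definition aas :: "(nat \<Rightarrow> 'b pmf) \<Rightarrow> (nat \<Rightarrow> 'b \<Rightarrow> bool) \<Rightarrow> bool" where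
  "aas M P \<longleftrightarrow> (\<lambda>n. measure_pmf.prob (M n) {\<omega>. P n \<omega>}) \<longlonglongrightarrow> 1"

text \<open>\<open>X = \<Theta>(Y)\<close> asymptotically almost surely, for sequences of nonnegative random variables;
  the constants depend neither on \<open>n\<close> nor on the outcome.\<close>

definition aas_bigtheta ::
    "(nat \<Rightarrow> 'b pmf) \<Rightarrow> (nat \<Rightarrow> 'b \<Rightarrow> ereal) \<Rightarrow> (nat \<Rightarrow> 'b \<Rightarrow> ereal) \<Rightarrow> bool" where
  "aas_bigtheta M X Y \<longleftrightarrow> (\<exists>c>0. \<exists>C>0. aas M (\<lambda>n \<omega>.
     ereal c * Y n \<omega> \<le> X n \<omega> \<and> X n \<omega> \<le> ereal C * Y n \<omega>))"

end

theory Submission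
  imports Defs "HOL-Real_Asymp.Real_Asymp"
begin

text \<open>A query \<open>(u, v)\<close> \<^emph>\<open>splits\<close> \<open>x\<close> from \<open>y\<close> if \<open>x\<close> is strictly closer to \<open>u\<close> and \<open>y\<close> strictly closer
  to \<open>v\<close>: no reply is truthful for both. Hence a set of queries that splits all pairs of vertices
  locates the target without any adaptivity. In the random graph take the \<open>O(log n)\<close> disjoint pairs
  \<open>(2 * i, 2 * i + 1)\<close>. Such a pair is an edge that splits \<open>x\<close> from \<open>y\<close> as soon as \<open>2 * i\<close> is adjacent to
  \<open>2 * i + 1\<close> and \<open>x\<close> but not to \<open>y\<close>, and \<open>2 * i + 1\<close> is adjacent to \<open>y\<close> but not to \<open>x\<close>. This has probability
  \<open>p\<^sup>3 (1 - p)\<^sup>2\<close>, independently for different \<open>i\<close>, so a union bound over \<open>x\<close> and \<open>y\<close> suffices.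
  Conversely, \<open>t\<close> queries admit only \<open>2\<^sup>t\<close> sequences of replies, hence distinguish at most that many
  vertices.\<close>

section \<open>Query numbers of a fixed graph\<close>

definition splits :: "'a set set \<Rightarrow> 'a \<times> 'a \<Rightarrow> 'a \<Rightarrow> 'a \<Rightarrow> bool" where
  "splits E q x y \<longleftrightarrow> (case q of (u, v) \<Rightarrow>
     graph_dist E u x < graph_dist E v x \<and> graph_dist E v y < graph_dist E u y)"

lemma graph_dist_adjacent_le:
  assumes "{u, v} \<in> E"
  shows "graph_dist E u v \<le> enat 1"
proof -
  have "(u, v) \<in> adj E ^^ 1"
    using assms by (simp add: adj_def)
  then show ?thesis
    unfolding graph_dist_def by (intro Inf_lower) blast
qed

text \<open>Only walks of length 0 and 1 have to be ruled out. Without any walk the infimum is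
  \<infinity>, so pairs in different components are covered.\<close>

lemma graph_dist_nonadjacent_ge:
  assumes "{u, v} \<notin> E" "u \<noteq> v"
  shows "enat 2 \<le> graph_dist E u v"
  unfolding graph_dist_def
proof (intro Inf_greatest, clarify)
  fix k assume k: "(u, v) \<in> adj E ^^ k"
  have "k \<noteq> 0" "k \<noteq> 1"
    using k assms by (intro notI; simp add: adj_def)+
  then show "enat 2 \<le> enat k"
    by simp
qed

lemma graph_dist_adjacent_less_nonadjacent:
  assumes "{u, x} \<in> E" "{v, x} \<notin> E" "v \<noteq> x"
  shows "graph_dist E u x < graph_dist E v x"
proof -
  have "graph_dist E u x \<le> enat 1"
    using assms(1) by (rule graph_dist_adjacent_le)
  also have "enat 1 < enat 2"
    by simp
  also have "\<dots> \<le> graph_dist E v x"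
    using assms(2,3) by (rule graph_dist_nonadjacent_ge)
  finally show ?thesis .
qed

text \<open>Comparing 1 with at least 2 settles both inequalities, so splitting is certified by the
  status of four vertex pairs. This makes it a local condition in the random graph.\<close>

lemma splitsI:
  assumes "{u, x} \<in> E" "{v, y} \<in> E" "{v, x} \<notin> E" "{u, y} \<notin> E" "v \<noteq> x" "u \<noteq> y"
  shows "splits E (u, v) x y"
  using assms by (simp add: splits_def graph_dist_adjacent_less_nonadjacent)

lemma truthful_reply_splits:
  assumes "splits E q x y" "truthful_reply E q r x"
  shows "\<not> truthful_reply E q r y"
  using assms by (auto simp: splits_def truthful_reply_def)

section \<open>Upper bound without adaptivity\<close>

lemma can_locate_splitting:
  assumes R: "finite R" "R \<subseteq> Q"
    and split: "\<And>x y. x \<in> V \<Longrightarrow> y \<in> V \<Longrightarrow> x \<noteq> y \<Longrightarrow> \<exists>q\<in>R. splits E q x y"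
  shows "can_locate V E Q (card R)"
proof -
  obtain qs where qs: "set qs = R" "distinct qs"
    using R(1) finite_distinct_list by blast
  \<comment> \<open>The queries are asked in a fixed order; the replies enter only through their
    number, which is the index of the next query.\<close>
  define \<sigma> :: "'a strategy" where "\<sigma> = (\<lambda>rs. qs ! length rs)"
  have len: "length qs = card R"
    using qs distinct_card by fastforce
  \<comment> \<open>Invariant of the induction: a query splitting two candidates would have
    eliminated one of them.\<close>
  have cand: "x \<in> V \<and> y \<in> V \<and> (\<forall>j<length rs. \<not> splits E (qs ! j) x y)"
    if "x \<in> candidates V E \<sigma> rs" "y \<in> candidates V E \<sigma> rs" for x y rs
    using that
  proof (induction rs)
    case (Cons r rs)
    then show ?case
      by (auto simp: \<sigma>_def less_Suc_eq dest: truthful_reply_splits)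
  qed simp
  have "card (candidates V E \<sigma> rs) = 1"
    if "length rs = card R" "x \<in> candidates V E \<sigma> rs" for x rs
  proof -
    have "y = x" if "y \<in> candidates V E \<sigma> rs" for y
    proof (rule ccontr)
      assume "y \<noteq> x"
      with cand[OF that \<open>x \<in> candidates V E \<sigma> rs\<close>] split obtain q where
        q: "q \<in> R" "splits E q y x"
        by blast
      then obtain j where "j < length qs" "q = qs ! j"
        using qs(1) by (metis in_set_conv_nth)
      then show False
        using cand[OF that \<open>x \<in> candidates V E \<sigma> rs\<close>] q len \<open>length rs = card R\<close> by simp
    qed
    with that(2) have "candidates V E \<sigma> rs = {x}"
      by blast
    then show ?thesis
      by simp
  qed
  moreover have "\<sigma> rs \<in> Q" if "length rs < card R" for rs
    using that qs(1) R(2) len by (auto simp: \<sigma>_def dest: nth_mem)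
  ultimately show ?thesis
    unfolding can_locate_def by blast
qed

section \<open>Lower bound by counting reply sequences\<close>

lemma truthful_reply_exists: "\<exists>r\<in>{fst q, snd q}. truthful_reply E q r x"
  by (auto simp: truthful_reply_def split: prod.split)

text \<open>In the binary tree of replies each target has a truthful branch at every node, so it
  survives at some leaf. Ties let the leaves overlap, hence a cover rather than a partition.\<close>

lemma candidates_cover:
  "\<exists>R. finite R \<and> card R \<le> 2 ^ t \<and> (\<forall>rs\<in>R. length rs = t) \<and>
     V \<subseteq> (\<Union>rs\<in>R. candidates V E \<sigma> rs)"
proof (induction t)
  case 0
  show ?case
    by (intro exI[of _ "{[]}"]) simp
next
  case (Suc t)
  then obtain R where R: "finite R" "card R \<le> 2 ^ t" "\<forall>rs\<in>R. length rs = t"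
    "V \<subseteq> (\<Union>rs\<in>R. candidates V E \<sigma> rs)"
    by blast
  define ext where "ext = (\<lambda>rs. {fst (\<sigma> rs) # rs, snd (\<sigma> rs) # rs})"
  have "card (\<Union>rs\<in>R. ext rs) \<le> (\<Sum>rs\<in>R. card (ext rs))"
    using R(1) by (rule card_UN_le)
  also have "\<dots> \<le> card R * 2"
    by (intro order.trans[OF sum_bounded_above[of _ _ 2]])
       (auto simp: ext_def card_insert_if)
  also have "\<dots> \<le> 2 ^ Suc t"
    using R(2) by simp
  finally have "card (\<Union>rs\<in>R. ext rs) \<le> 2 ^ Suc t" .
  moreover have "V \<subseteq> (\<Union>rs\<in>(\<Union>rs\<in>R. ext rs). candidates V E \<sigma> rs)"
  proof
    fix x assume "x \<in> V"
    then obtain rs where rs: "rs \<in> R" "x \<in> candidates V E \<sigma> rs"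
      using R(4) by blast
    obtain r where "r \<in> {fst (\<sigma> rs), snd (\<sigma> rs)}" "truthful_reply E (\<sigma> rs) r x"
      using truthful_reply_exists by meson
    with rs have "r # rs \<in> ext rs" "x \<in> candidates V E \<sigma> (r # rs)"
      by (auto simp: ext_def)
    with rs(1) show "x \<in> (\<Union>rs\<in>(\<Union>rs\<in>R. ext rs). candidates V E \<sigma> rs)"
      by blast
  qed
  ultimately show ?case
    using R(1,3) by (intro exI[of _ "\<Union>rs\<in>R. ext rs"]) (auto simp: ext_def)
qed

text \<open>Each of the at most \<open>2 ^ t\<close> leaves of the reply tree retains at most one
  vertex.\<close>

lemma can_locate_card_le:
  assumes "can_locate V E Q t"
  shows "card V \<le> 2 ^ t"
proof -
  obtain \<sigma> where \<sigma>: "card (candidates V E \<sigma> rs) = 1"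
    if "x \<in> V" "length rs = t" "x \<in> candidates V E \<sigma> rs" for x rs
    using assms unfolding can_locate_def by blast
  obtain R where R: "finite R" "card R \<le> 2 ^ t" "\<forall>rs\<in>R. length rs = t"
    "V \<subseteq> (\<Union>rs\<in>R. candidates V E \<sigma> rs)"
    using candidates_cover by meson
  have sub: "candidates V E \<sigma> rs \<subseteq> V" for rs
    by (induction rs) auto
  \<comment> \<open>Infinite sets have cardinality 0, so cardinality 1 also yields finiteness, which
    \<open>card_mono\<close> requires of the union.\<close>
  have fin: "finite (candidates V E \<sigma> rs) \<and> card (candidates V E \<sigma> rs) \<le> 1" if "rs \<in> R" for rs
  proof (cases "candidates V E \<sigma> rs = {}")
    case False
    then have "card (candidates V E \<sigma> rs) = 1"
      using \<sigma> sub R(3) that by blast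
    then show ?thesis
      by (simp add: card_ge_0_finite)
  qed simp
  have "card V \<le> card (\<Union>rs\<in>R. candidates V E \<sigma> rs)"
    using R fin by (intro card_mono) auto
  also have "\<dots> \<le> (\<Sum>rs\<in>R. card (candidates V E \<sigma> rs))"
    using R(1) by (rule card_UN_le)
  also have "\<dots> \<le> card R"
    using fin sum_mono[of R "\<lambda>rs. card (candidates V E \<sigma> rs)" "\<lambda>_. 1"] by simp
  finally show ?thesis
    using R(2) by simp
qed

section \<open>Comparing the two query numbers\<close>

lemma pq_num_le_eq_num:
  assumes "adj E \<subseteq> V \<times> V"
  shows "pq_num V E \<le> eq_num V E"
proof -
  have "can_locate V E (V \<times> V) t" if "can_locate V E (adj E) t" for t
    using that assms unfolding can_locate_def by blast
  then show ?thesis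
    unfolding pq_num_def eq_num_def by (intro Inf_superset_mono) blast
qed

lemma eq_num_le:
  assumes "can_locate V E (adj E) t"
  shows "eq_num V E \<le> enat t"
  unfolding eq_num_def using assms by (intro Inf_lower) blast

text \<open>A finite value rules out the empty set, whose infimum is \<infinity>; a nonempty set in
  the well-order \<open>enat\<close> contains its infimum.\<close>

lemma pq_num_eq_enatD:
  assumes "pq_num V E = enat t"
  shows "can_locate V E (V \<times> V) t"
proof -
  let ?T = "{enat t | t. can_locate V E (V \<times> V) t}"
  have "?T \<noteq> {}"
    using assms by (auto simp: pq_num_def Inf_enat_def simp del: not_all)
  then have "Inf ?T \<in> ?T"
    by (metis (no_types, lifting) ex_in_conv wellorder_InfI)
  then show ?thesis
    using assms by (auto simp: pq_num_def)
qed

text \<open>A sandwich: counting bounds \<open>a\<close> from below, pair queries include edge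
  queries, and asking all of \<open>R\<close> bounds \<open>b\<close> from above.\<close>

lemma query_num_bounds:
  assumes V: "V \<noteq> {}" "finite V" and E: "adj E \<subseteq> V \<times> V"
    and R: "finite R" "R \<subseteq> adj E"
    and split: "\<And>x y. x \<in> V \<Longrightarrow> y \<in> V \<Longrightarrow> x \<noteq> y \<Longrightarrow> \<exists>q\<in>R. splits E q x y"
  obtains a b where "pq_num V E = enat a" "eq_num V E = enat b" "a \<le> b" "b \<le> card R"
    "ln (real (card V)) \<le> real a * ln 2"
proof -
  have "eq_num V E \<le> enat (card R)"
    using can_locate_splitting[OF R split] by (rule eq_num_le)
  then obtain b where b: "eq_num V E = enat b" "b \<le> card R"
    by (cases "eq_num V E") auto
  with pq_num_le_eq_num[OF E] obtain a where a: "pq_num V E = enat a" "a \<le> b"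
    by (cases "pq_num V E") auto
  have "card V \<le> 2 ^ a"
    using pq_num_eq_enatD[OF a(1)] by (rule can_locate_card_le)
  then have "real (card V) \<le> 2 ^ a"
    by (metis of_nat_le_iff of_nat_numeral of_nat_power)
  then have "ln (real (card V)) \<le> ln (2 ^ a)"
    using V by (subst ln_le_cancel_iff) (auto simp: card_gt_0_iff)
  then have "ln (real (card V)) \<le> real a * ln 2"
    by (simp add: ln_realpow)
  with a b show ?thesis
    using that by blast
qed

section \<open>Splitting edges in the random graph\<close>

lemma prob_pattern:
  fixes p :: real
  assumes "finite A" "T \<union> F \<subseteq> A" "T \<inter> F = {}" "0 \<le> p" "p \<le> 1"
  shows "measure_pmf.prob (Pi_pmf A False (\<lambda>_. bernoulli_pmf p))
           {f. (\<forall>e\<in>T. f e) \<and> (\<forall>e\<in>F. \<not> f e)} = p ^ card T * (1 - p) ^ card F"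
proof -
  \<comment> \<open>The event is a box: coordinates in \<open>T\<close> and \<open>F\<close> are
    fixed, all others are free and contribute the factor 1.\<close>
  define B where "B = (\<lambda>e. if e \<in> T then {True} else if e \<in> F then {False} else UNIV)"
  have fin: "finite T" "finite F"
    using assms by (auto intro: finite_subset)
  have "{f. (\<forall>e\<in>T. f e) \<and> (\<forall>e\<in>F. \<not> f e)} = Pi A B"
    using assms(2,3) by (auto simp: B_def Pi_def split: if_splits)
  then have "measure_pmf.prob (Pi_pmf A False (\<lambda>_. bernoulli_pmf p))
      {f. (\<forall>e\<in>T. f e) \<and> (\<forall>e\<in>F. \<not> f e)} = (\<Prod>e\<in>A. measure_pmf.prob (bernoulli_pmf p) (B e))"
    using assms(1) by (simp add: measure_Pi_pmf_Pi)
  also have "\<dots> = (\<Prod>e\<in>T \<union> F. measure_pmf.prob (bernoulli_pmf p) (B e))"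
    using assms(1,2) by (intro prod.mono_neutral_right) (auto simp: B_def)
  also have "\<dots> = (\<Prod>e\<in>T. measure_pmf.prob (bernoulli_pmf p) (B e)) *
      (\<Prod>e\<in>F. measure_pmf.prob (bernoulli_pmf p) (B e))"
    using fin assms(3) by (rule prod.union_disjoint)
  also have "(\<Prod>e\<in>T. measure_pmf.prob (bernoulli_pmf p) (B e)) = p ^ card T"
    using assms(4,5) by (simp add: B_def measure_pmf_single)
  also have "(\<Prod>e\<in>F. measure_pmf.prob (bernoulli_pmf p) (B e)) = (\<Prod>e\<in>F. 1 - p)"
    using assms(3,4,5) by (intro prod.cong) (auto simp: B_def measure_pmf_single)
  finally show ?thesis
    by simp
qed

text \<open>Patterns on disjoint sets of coordinates are independent, and so are their complements;
  each factor is the complementary probability of a single pattern.\<close>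

lemma prob_no_pattern:
  fixes p :: real
  assumes A: "finite A" and I: "finite I"
    and TF: "\<And>i. i \<in> I \<Longrightarrow> T i \<union> F i \<subseteq> A" "\<And>i. i \<in> I \<Longrightarrow> T i \<inter> F i = {}"
    and disj: "disjoint_family_on (\<lambda>i. T i \<union> F i) I"
    and p: "0 \<le> p" "p \<le> 1"
  shows "measure_pmf.prob (Pi_pmf A False (\<lambda>_. bernoulli_pmf p))
           {f. \<forall>i\<in>I. \<not> ((\<forall>e\<in>T i. f e) \<and> (\<forall>e\<in>F i. \<not> f e))} =
         (\<Prod>i\<in>I. 1 - p ^ card (T i) * (1 - p) ^ card (F i))"
\<comment> \<open>The product formula of \<open>indep_events\<close> concerns nonempty index sets;
  for empty \<open>I\<close> both sides are 1.\<close>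
proof (cases "I = {}")
  case False
  let ?M = "Pi_pmf A False (\<lambda>_. bernoulli_pmf p)"
  let ?P = "\<lambda>i f. (\<forall>e\<in>T i. f e) \<and> (\<forall>e\<in>F i. \<not> f e)"
  let ?K = "\<lambda>i. T i \<union> F i"
  have fin: "finite (T i)" "finite (F i)" if "i \<in> I" for i
    using TF(1)[OF that] A by (auto intro: finite_subset)
  \<comment> \<open>Restrictions of \<open>f\<close> to disjoint blocks are independent, and failure
    of pattern \<open>i\<close> is a measurable condition on block \<open>i\<close> alone.\<close>
  have "prob_space.indep_vars ?M (\<lambda>i. Pi\<^sub>M (?K i) (\<lambda>_. count_space UNIV))
      (\<lambda>i f. restrict f (?K i)) I"
    using prob_space.indep_vars_restrict[OF measure_pmf.prob_space_axioms indep_vars_Pi_pmf[OF A],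
        of I ?K] TF(1) disj by simp
  then have "prob_space.indep_events ?M
      (\<lambda>i. {f \<in> space ?M. \<not> ?P i (restrict f (?K i))}) I"
  proof (rule prob_space.indep_eventsI_indep_vars[OF measure_pmf.prob_space_axioms])
    fix i assume i: "i \<in> I"
    show "{g \<in> space (Pi\<^sub>M (?K i) (\<lambda>_. count_space UNIV)). \<not> ?P i g} \<in>
        sets (Pi\<^sub>M (?K i) (\<lambda>_. count_space UNIV))"
      using fin[OF i]
      by (intro sets.sets_Collect_neg sets.sets_Collect_conj sets.sets_Collect_finite_All)
         (auto intro!: predE measurable_component_singleton)
  qed
  then have "measure_pmf.prob ?M (\<Inter>i\<in>I. {f. \<not> ?P i f}) =
      (\<Prod>i\<in>I. measure_pmf.prob ?M {f. \<not> ?P i f})"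
    using False I by (simp add: prob_space.indep_events_def[OF measure_pmf.prob_space_axioms])
  also have "(\<Inter>i\<in>I. {f. \<not> ?P i f}) = {f. \<forall>i\<in>I. \<not> ?P i f}"
    by blast
  also have "(\<Prod>i\<in>I. measure_pmf.prob ?M {f. \<not> ?P i f}) =
      (\<Prod>i\<in>I. 1 - p ^ card (T i) * (1 - p) ^ card (F i))"
  proof (rule prod.cong)
    fix i assume i: "i \<in> I"
    have "measure_pmf.prob ?M {f. \<not> ?P i f} = 1 - measure_pmf.prob ?M {f. ?P i f}"
      using measure_pmf.prob_neg[of ?M "?P i"] by simp
    then show "measure_pmf.prob ?M {f. \<not> ?P i f} = 1 - p ^ card (T i) * (1 - p) ^ card (F i)"
      using prob_pattern[OF A TF[OF i] p] by simp
  qed simp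
  finally show ?thesis .
qed simp

section \<open>Splitting edges and the union bound\<close>

text \<open>The pairs are fixed before the graph is drawn; intersecting with \<open>adj E\<close>
  keeps only legal edge queries. Starting at 1 avoids the non-vertex 0.\<close>

definition split_edges :: "nat set set \<Rightarrow> nat \<Rightarrow> (nat \<times> nat) set" where
  "split_edges E m = adj E \<inter> (\<lambda>i. (2 * i, 2 * i + 1)) ` {1..m}"

lemma card_split_edges_le: "card (split_edges E m) \<le> m"
proof -
  have "card (split_edges E m) \<le> card ((\<lambda>i. (2 * i, 2 * i + 1)) ` {1..m})"
    unfolding split_edges_def by (intro card_mono) auto
  also have "\<dots> \<le> m"
    using card_image_le[of "{1..m}"] by simp
  finally show ?thesis .
qed

definition all_split :: "nat \<Rightarrow> nat \<Rightarrow> nat set set \<Rightarrow> bool" where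
  "all_split n m E \<longleftrightarrow>
     (\<forall>x\<in>{1..n}. \<forall>y\<in>{1..n}. x \<noteq> y \<longrightarrow> (\<exists>q\<in>split_edges E m. splits E q x y))"

lemma finite_vertex_pairs: "finite (vertex_pairs n)"
  unfolding vertex_pairs_def by (rule finite_subset[of _ "Pow {1..n}"]) auto

lemma prob_not_split_le:
  fixes p :: real
  assumes p: "0 < p" "p < 1" and m: "2 * m + 1 \<le> n" and xy: "x \<in> {1..n}" "y \<in> {1..n}" "x \<noteq> y"
  shows "measure_pmf.prob (gnp n p) {E. \<not> (\<exists>q\<in>split_edges E m. splits E q x y)} \<le>
           (1 - p ^ 3 * (1 - p) ^ 2) ^ (m - 2)"
proof -
  let ?q = "p ^ 3 * (1 - p) ^ 2"
  let ?M = "Pi_pmf (vertex_pairs n) False (\<lambda>_. bernoulli_pmf p)"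
  \<comment> \<open>Indices whose pair contains \<open>x\<close> or \<open>y\<close> are dropped;
    for the others the five pairs in \<open>T i\<close> and \<open>F i\<close> are genuine and
    distinct. At most two indices are lost, hence the exponent \<open>m - 2\<close>.\<close>
  define I where "I = {1..m} - {x div 2, y div 2}"
  define T where "T = (\<lambda>i. {{2 * i, 2 * i + 1}, {2 * i, x}, {2 * i + 1, y}})"
  define F where "F = (\<lambda>i. {{2 * i + 1, x}, {2 * i, y}})"
  have ne: "x \<noteq> 2 * i" "x \<noteq> 2 * i + 1" "y \<noteq> 2 * i" "y \<noteq> 2 * i + 1" if "i \<in> I" for i
    using that by (auto simp: I_def)
  have cards: "card (T i) = 3" "card (F i) = 2" if "i \<in> I" for i
    using ne[OF that] xy(3) by (auto simp: T_def F_def card_insert_if doubleton_eq_iff)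
  have sub: "T i \<union> F i \<subseteq> vertex_pairs n" "T i \<inter> F i = {}" if "i \<in> I" for i
    using ne[OF that] xy m that
    by (auto simp: T_def F_def I_def vertex_pairs_def doubleton_eq_iff card_insert_if)
  \<comment> \<open>Every element of block \<open>i\<close> has an endpoint in
    \<open>{2 * i, 2 * i + 1}\<close>. These pairs are disjoint for different \<open>i\<close> and
    avoid \<open>x\<close> and \<open>y\<close>, so no element lies in two blocks.\<close>
  have disj: "disjoint_family_on (\<lambda>i. T i \<union> F i) I"
    unfolding disjoint_family_on_def
  proof (intro ballI impI)
    fix i j assume ij: "i \<in> I" "j \<in> I" "i \<noteq> j"
    have "2 * i \<noteq> 2 * j + 1" "2 * i + 1 \<noteq> 2 * j"
      by presburger+
    then show "(T i \<union> F i) \<inter> (T j \<union> F j) = {}"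
      using ij(3) ne[OF ij(1)] ne[OF ij(2)] by (simp add: T_def F_def doubleton_eq_iff)
  qed
  have split: "\<exists>q\<in>split_edges E m. splits E q x y"
    if i: "i \<in> I" and TF: "T i \<subseteq> E" "F i \<inter> E = {}" for E i
  proof -
    have "splits E (2 * i, 2 * i + 1) x y"
      using TF ne[OF i] by (intro splitsI) (auto simp: T_def F_def)
    moreover have "(2 * i, 2 * i + 1) \<in> split_edges E m"
      using i TF by (auto simp: split_edges_def adj_def T_def I_def)
    ultimately show ?thesis
      by blast
  qed
  have "measure_pmf.prob (gnp n p) {E. \<not> (\<exists>q\<in>split_edges E m. splits E q x y)} \<le>
      measure_pmf.prob ?M {f. \<forall>i\<in>I. \<not> ((\<forall>e\<in>T i. f e) \<and> (\<forall>e\<in>F i. \<not> f e))}"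
    unfolding gnp_def measure_map_pmf
  proof (rule measure_pmf.finite_measure_mono)
    show "(\<lambda>f. {e \<in> vertex_pairs n. f e}) -` {E. \<not> (\<exists>q\<in>split_edges E m. splits E q x y)} \<subseteq>
        {f. \<forall>i\<in>I. \<not> ((\<forall>e\<in>T i. f e) \<and> (\<forall>e\<in>F i. \<not> f e))}"
    proof (intro subsetI CollectI ballI notI)
      fix f i
      assume none: "f \<in> (\<lambda>f. {e \<in> vertex_pairs n. f e}) -`
          {E. \<not> (\<exists>q\<in>split_edges E m. splits E q x y)}"
        and i: "i \<in> I" and TF: "(\<forall>e\<in>T i. f e) \<and> (\<forall>e\<in>F i. \<not> f e)"
      have "\<exists>q\<in>split_edges {e \<in> vertex_pairs n. f e} m. splits {e \<in> vertex_pairs n. f e} q x y"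
        using TF sub(1)[OF i] by (intro split[OF i]) auto
      with none show False
        by simp
    qed
  qed simp
  also have "\<dots> = (\<Prod>i\<in>I. 1 - p ^ card (T i) * (1 - p) ^ card (F i))"
    using p sub disj finite_vertex_pairs by (intro prob_no_pattern) (auto simp: I_def)
  also have "\<dots> = (1 - ?q) ^ card I"
    using cards by simp
  also have "\<dots> \<le> (1 - ?q) ^ (m - 2)"
  proof (rule power_decreasing)
    have "card {x div 2, y div 2} \<le> 2"
      by (simp add: card_insert_if)
    moreover have "m - card {x div 2, y div 2} \<le> card I"
      using diff_card_le_card_Diff[of "{x div 2, y div 2}" "{1..m}"] by (simp add: I_def)
    ultimately show "m - 2 \<le> card I"
      by linarith
    show "0 \<le> 1 - ?q" "1 - ?q \<le> 1"
      using p by (simp_all add: mult_le_one power_le_one)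
  qed
  finally show ?thesis .
qed

text \<open>Union bound over ordered pairs, since \<open>splits\<close> is not symmetric in
  \<open>x\<close> and \<open>y\<close>; there are at most \<open>n * n\<close> of them.\<close>

lemma prob_all_split_ge:
  fixes p :: real
  assumes p: "0 < p" "p < 1" and m: "2 * m + 1 \<le> n"
  shows "1 - (real n)\<^sup>2 * (1 - p ^ 3 * (1 - p) ^ 2) ^ (m - 2) \<le>
           measure_pmf.prob (gnp n p) {E. all_split n m E}"
proof -
  let ?b = "(1 - p ^ 3 * (1 - p) ^ 2) ^ (m - 2)"
  let ?bad = "\<lambda>s. {E. \<not> (\<exists>q\<in>split_edges E m. splits E q (fst s) (snd s))}"
  let ?S = "{s \<in> {1..n} \<times> {1..n}. fst s \<noteq> snd s}"
  have fin: "finite ?S"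
    by (rule finite_subset[of _ "{1..n} \<times> {1..n}"]) auto
  have "card ?S \<le> card ({1..n} \<times> {1..n})"
    by (intro card_mono) auto
  then have card: "real (card ?S) \<le> (real n)\<^sup>2"
    by (simp add: power2_eq_square flip: of_nat_mult)
  have "0 \<le> 1 - p ^ 3 * (1 - p) ^ 2"
    using p by (simp add: mult_le_one power_le_one)
  then have b: "0 \<le> ?b"
    by simp
  have "{E. \<not> all_split n m E} = (\<Union>s\<in>?S. ?bad s)"
  proof (intro set_eqI iffI)
    fix E assume "E \<in> {E. \<not> all_split n m E}"
    then obtain x y where "(x, y) \<in> ?S" "E \<in> ?bad (x, y)"
      unfolding all_split_def by auto
    then show "E \<in> (\<Union>s\<in>?S. ?bad s)"
      by (rule UN_I)
  next
    fix E assume "E \<in> (\<Union>s\<in>?S. ?bad s)"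
    then show "E \<in> {E. \<not> all_split n m E}"
      unfolding all_split_def by fastforce
  qed
  then have "measure_pmf.prob (gnp n p) {E. \<not> all_split n m E} =
      measure_pmf.prob (gnp n p) (\<Union>s\<in>?S. ?bad s)"
    by simp
  also have "\<dots> \<le> (\<Sum>s\<in>?S. measure_pmf.prob (gnp n p) (?bad s))"
    using fin by (intro measure_pmf.finite_measure_subadditive_finite) auto
  also have "\<dots> \<le> real (card ?S) * ?b"
    using prob_not_split_le[OF p m] by (intro sum_bounded_above) auto
  also have "\<dots> \<le> (real n)\<^sup>2 * ?b"
    using card b by (rule mult_right_mono)
  finally show ?thesis
    using measure_pmf.prob_neg[of "gnp n p" "all_split n m"] by simp
qed

lemma all_split_query_num_bounds:
  assumes "all_split n m E" "E \<subseteq> vertex_pairs n" "0 < n"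
  obtains a b where "pq_num {1..n} E = enat a" "eq_num {1..n} E = enat b" "a \<le> b" "b \<le> m"
    "ln (real n) \<le> real a * ln 2"
proof (rule query_num_bounds)
  show "{1..n} \<noteq> {}"
    using assms(3) by simp
  show "adj E \<subseteq> {1..n} \<times> {1..n}"
    using assms(2) by (auto simp: adj_def vertex_pairs_def)
  show "finite (split_edges E m)" "split_edges E m \<subseteq> adj E"
    by (auto simp: split_edges_def)
  show "\<exists>q\<in>split_edges E m. splits E q x y" if "x \<in> {1..n}" "y \<in> {1..n}" "x \<noteq> y" for x y
    using assms(1) that unfolding all_split_def by blast
qed (use that card_split_edges_le[of E m] in auto)

text \<open>The factor \<open>3\<close> makes the failure probability of each of the fewer than \<open>n\<^sup>2\<close> pairs \<open>O(n\<^sup>-\<^sup>3)\<close>.\<close>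

definition num_pairs :: "real \<Rightarrow> nat \<Rightarrow> nat" where
  "num_pairs p n = nat \<lceil>3 / (p ^ 3 * (1 - p) ^ 2) * ln (real n)\<rceil>"

section \<open>Asymptotics\<close>

lemma all_split_aas:
  fixes p :: real
  assumes p: "0 < p" "p < 1"
  shows "aas (\<lambda>n. gnp n p) (\<lambda>n. all_split n (num_pairs p n))"
proof -
  define q where "q = p ^ 3 * (1 - p) ^ 2"
  have q: "0 < q" "q \<le> 1"
    using p by (simp_all add: q_def mult_le_one power_le_one)
  define C where "C = 3 / q"
  have C: "0 < C" "q * C = 3"
    using q by (simp_all add: C_def)
  \<comment> \<open>The number of pairs is logarithmic, so they eventually fit into
    \<open>{1..n}\<close>; the inner summand 1 accounts for the ceiling in
    \<open>num_pairs\<close>.\<close>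
  have "eventually (\<lambda>n. 2 * (C * ln (real n) + 1) + 1 \<le> real n) at_top"
    using C by real_asymp
  then have lower: "eventually (\<lambda>n. 1 - exp (2 * q) / real n \<le>
      measure_pmf.prob (gnp n p) {E. all_split n (num_pairs p n) E}) at_top"
    using eventually_gt_at_top[of 0]
  proof eventually_elim
    case (elim n)
    let ?m = "num_pairs p n"
    have ln: "0 \<le> C * ln (real n)"
      using C elim by simp
    then have m_le: "real ?m \<le> C * ln (real n) + 1" and m_ge: "C * ln (real n) \<le> real ?m"
      unfolding num_pairs_def C_def q_def by linarith+
    have "real (2 * ?m + 1) \<le> real n"
      using m_le elim(1) by simp
    then have le_n: "2 * ?m + 1 \<le> n"
      by (simp only: of_nat_le_iff)
    have "(1 - q) ^ (?m - 2) \<le> exp (- q) ^ (?m - 2)"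
      using q exp_ge_add_one_self[of "- q"] by (intro power_mono) auto
    also have "\<dots> = exp (- q * real (?m - 2))"
      by (simp add: exp_of_nat_mult[symmetric] mult.commute)
    also have "\<dots> \<le> exp (2 * q - 3 * ln (real n))"
    proof -
      \<comment> \<open>Since \<open>q * C = 3\<close>, the two lost indices cost only the constant
        factor \<open>exp (2 * q)\<close>. Truncated subtraction is harmless here:
        \<open>real (?m - 2)\<close> is at least \<open>real ?m - 2\<close>.\<close>
      have "q * (C * ln (real n) - 2) \<le> q * real (?m - 2)"
        using q m_ge by (intro mult_left_mono) linarith+
      then show ?thesis
        using C(2) by (simp add: algebra_simps flip: mult.assoc)
    qed
    also have "\<dots> = exp (2 * q) / real n ^ 3"
      using elim exp_of_nat_mult[of 3 "ln (real n)"] by (simp add: exp_diff)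
    finally have "(real n)\<^sup>2 * (1 - q) ^ (?m - 2) \<le> (real n)\<^sup>2 * (exp (2 * q) / real n ^ 3)"
      by (intro mult_left_mono) auto
    also have "\<dots> = exp (2 * q) / real n"
      using elim by (simp add: power2_eq_square power3_eq_cube)
    finally have "1 - exp (2 * q) / real n \<le> 1 - (real n)\<^sup>2 * (1 - q) ^ (?m - 2)"
      by simp
    also have "\<dots> \<le> measure_pmf.prob (gnp n p) {E. all_split n ?m E}"
      unfolding q_def using le_n by (rule prob_all_split_ge[OF p])
    finally show ?case .
  qed
  have "(\<lambda>n. 1 - exp (2 * q) / real n) \<longlonglongrightarrow> 1"
    by real_asymp
  from tendsto_sandwich[OF lower _ this tendsto_const] show ?thesis
    unfolding aas_def by simp
qed

text \<open>Every outcome of \<open>gnp\<close> has the form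
  \<open>{e \<in> vertex_pairs n. f e}\<close>, so it suffices to compare the properties on graphs
  over \<open>{1..n}\<close>; finitely many \<open>n\<close> do not affect the limit.\<close>

lemma aas_gnp_mono:
  assumes "aas (\<lambda>n. gnp n p) P"
    and "eventually (\<lambda>n. \<forall>E. E \<subseteq> vertex_pairs n \<longrightarrow> P n E \<longrightarrow> Q n E) at_top"
  shows "aas (\<lambda>n. gnp n p) Q"
proof -
  have "eventually (\<lambda>n. measure_pmf.prob (gnp n p) {E. P n E} \<le>
      measure_pmf.prob (gnp n p) {E. Q n E}) at_top"
    using assms(2)
  proof eventually_elim
    case (elim n)
    then show ?case
      unfolding gnp_def measure_map_pmf by (intro measure_pmf.finite_measure_mono) auto
  qed
  from tendsto_sandwich[OF this _ assms(1)[unfolded aas_def] tendsto_const] show ?thesis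
    unfolding aas_def by simp
qed

lemma aas_bigthetaI:
  assumes "0 < c" "0 < C"
    and "aas M (\<lambda>n \<omega>. ereal c * Y n \<omega> \<le> X n \<omega> \<and> X n \<omega> \<le> ereal C * Y n \<omega>)"
  shows "aas_bigtheta M X Y"
  using assms unfolding aas_bigtheta_def by blast

theorem corollary1p3:
  fixes p :: real
  assumes "0 < p" and "p < 1"
  shows "aas_bigtheta (\<lambda>n. gnp n p)
           (\<lambda>n E. ereal_of_enat (pq_num {1..n} E)) (\<lambda>n E. ereal_of_enat (eq_num {1..n} E)) \<and>
         aas_bigtheta (\<lambda>n. gnp n p)
           (\<lambda>n E. ereal_of_enat (eq_num {1..n} E)) (\<lambda>n E. ereal (ln (real n))) \<and>
         aas_bigtheta (\<lambda>n. gnp n p)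
           (\<lambda>n E. ereal_of_enat (pq_num {1..n} E)) (\<lambda>n E. ereal (ln (real n)))"
proof -
  \<comment> \<open>The summand 1 absorbs the ceiling in \<open>num_pairs\<close> once
    \<open>ln n\<close> is at least 1.\<close>
  define D where "D = 3 / (p ^ 3 * (1 - p) ^ 2) + 1"
  have D: "0 < D"
    using assms by (auto simp: D_def intro!: add_nonneg_pos)
  define L where "L = ln (2 :: real)"
  have L: "0 < L"
    by (simp add: L_def)
  \<comment> \<open>A single event from which all three comparisons follow
    deterministically.\<close>
  define good where "good = (\<lambda>n E. \<exists>a b. pq_num {1..n} E = enat a \<and> eq_num {1..n} E = enat b \<and>
    a \<le> b \<and> real b \<le> D * ln (real n) \<and> ln (real n) \<le> real a * L)"
  have "eventually (\<lambda>n. 1 \<le> ln (real n)) at_top"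
    by real_asymp
  then have "eventually (\<lambda>n. \<forall>E. E \<subseteq> vertex_pairs n \<longrightarrow>
      all_split n (num_pairs p n) E \<longrightarrow> good n E) at_top"
    using eventually_gt_at_top[of 0]
  proof eventually_elim
    case (elim n)
    have "0 \<le> 3 / (p ^ 3 * (1 - p) ^ 2) * ln (real n)"
      using elim assms by (intro mult_nonneg_nonneg) auto
    then have "real (num_pairs p n) \<le> 3 / (p ^ 3 * (1 - p) ^ 2) * ln (real n) + 1"
      unfolding num_pairs_def by linarith
    also have "\<dots> \<le> D * ln (real n)"
      using elim by (simp add: D_def distrib_right)
    finally have m: "real (num_pairs p n) \<le> D * ln (real n)" .
    show ?case
    proof (intro allI impI)
      fix E assume "E \<subseteq> vertex_pairs n" "all_split n (num_pairs p n) E"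
      then obtain a b where "pq_num {1..n} E = enat a" "eq_num {1..n} E = enat b" "a \<le> b"
        "b \<le> num_pairs p n" "ln (real n) \<le> real a * L"
        using all_split_query_num_bounds elim(2) unfolding L_def by metis
      moreover from this m have "real b \<le> D * ln (real n)"
        by linarith
      ultimately show "good n E"
        unfolding good_def by blast
    qed
  qed
  with all_split_aas[OF assms] have good: "aas (\<lambda>n. gnp n p) good"
    by (rule aas_gnp_mono)
  have mono: "aas (\<lambda>n. gnp n p) Q" if "\<And>n E. good n E \<Longrightarrow> Q n E" for Q
    using good by (rule aas_gnp_mono) (simp add: that)
  have "aas_bigtheta (\<lambda>n. gnp n p)
      (\<lambda>n E. ereal_of_enat (pq_num {1..n} E)) (\<lambda>n E. ereal_of_enat (eq_num {1..n} E))"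
  \<comment> \<open>The chain \<open>b \<le> D * ln n \<le> D * L * a\<close> gives
    \<open>c = 1 / (D * L)\<close>; \<open>C = 1\<close> reflects \<open>a \<le> b\<close>.\<close>
  proof (intro aas_bigthetaI[where c = "1 / (D * L)" and C = 1] conjI mono)
    fix n E assume "good n E"
    then obtain a b where ab: "pq_num {1..n} E = enat a" "eq_num {1..n} E = enat b"
      "a \<le> b" "real b \<le> D * ln (real n)" "ln (real n) \<le> real a * L"
      unfolding good_def by blast
    note ab(4)
    also have "D * ln (real n) \<le> D * (real a * L)"
      using ab(5) D by (intro mult_left_mono) auto
    finally show "ereal (1 / (D * L)) * ereal_of_enat (eq_num {1..n} E) \<le>
        ereal_of_enat (pq_num {1..n} E)"
      using ab D L by (simp add: field_simps)
    show "ereal_of_enat (pq_num {1..n} E) \<le> ereal 1 * ereal_of_enat (eq_num {1..n} E)"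
      using ab by simp
  qed (use D L in auto)
  moreover have "aas_bigtheta (\<lambda>n. gnp n p)
      (\<lambda>n E. ereal_of_enat (eq_num {1..n} E)) (\<lambda>n E. ereal (ln (real n)))"
  \<comment> \<open>Counting gives \<open>ln n \<le> L * a \<le> L * b\<close>, whence
    \<open>c = 1 / L\<close>; \<open>C = D\<close> comes from the number of queried pairs.\<close>
  proof (intro aas_bigthetaI[where c = "1 / L" and C = D] conjI mono)
    fix n E assume "good n E"
    then obtain a b where ab: "eq_num {1..n} E = enat b"
      "a \<le> b" "real b \<le> D * ln (real n)" "ln (real n) \<le> real a * L"
      unfolding good_def by blast
    have "real a * L \<le> real b * L"
      using ab(2) L by simp
    with ab(4) have "ln (real n) \<le> real b * L"
      by simp
    then show "ereal (1 / L) * ereal (ln (real n)) \<le> ereal_of_enat (eq_num {1..n} E)"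
      using ab(1) L by (simp add: field_simps)
    show "ereal_of_enat (eq_num {1..n} E) \<le> ereal D * ereal (ln (real n))"
      using ab by simp
  qed (use D L in auto)
  moreover have "aas_bigtheta (\<lambda>n. gnp n p)
      (\<lambda>n E. ereal_of_enat (pq_num {1..n} E)) (\<lambda>n E. ereal (ln (real n)))"
  \<comment> \<open>The same constants serve: counting bounds \<open>a\<close> directly, and the
    upper bound on \<open>b\<close> passes to \<open>a\<close>.\<close>
  proof (intro aas_bigthetaI[where c = "1 / L" and C = D] conjI mono)
    fix n E assume "good n E"
    then obtain a b where ab: "pq_num {1..n} E = enat a"
      "a \<le> b" "real b \<le> D * ln (real n)" "ln (real n) \<le> real a * L"
      unfolding good_def by blast
    show "ereal (1 / L) * ereal (ln (real n)) \<le> ereal_of_enat (pq_num {1..n} E)"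
      using ab(1,4) L by (simp add: field_simps)
    show "ereal_of_enat (pq_num {1..n} E) \<le> ereal D * ereal (ln (real n))"
      using ab by simp
  qed (use D L in auto)
  ultimately show ?thesis
    by blast
qed

end
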